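(* Let $p\in(0,1)$ be a constant and $q = 1 - 2p(1-p)^2(2-p)$. Then asymptotically almost surely the Erdős–Rényi random graph $G(n,p)$ satisfies $$\operatorname{edim}(G(n,p)) \ge (1+o(1))\frac{4\log(n)}{\log(1/q)},$$ where $o(1)\to 0$ as $n\to\infty$.
   Context: $G(n,p)$ is the Erdős–Rényi random graph on $n$ vertices, each possible edge present independently with probability $p$. For vertices $u,v$, $d(u,v)$ is the shortest-path distance; for an edge $e=xy$ and vertex $v$, $d(e,v)=\min\{d(x,v),d(y,v)\}$. For $R=\{r_1,\dots,r_k\}\subseteq V$ and an edge $e$, $d_R(e)=(d(e,r_1),\dots,d(e,r_k))$. $R$ is an edge generating set if $d_R(e_1)\neq d_R(e_2)$ for all distinct edges $e_1,e_2$; $\operatorname{edim}(G)$ is the minimum size of an edge generating set. A property holds asymptotically almost surely (a.a.s.) if its probability for $G(n,p)$ tends to $1$ as $n\to\infty$. *)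

theory Defs
  imports "HOL-Probability.Probability" "HOL-Library.Ramsey"
begin

(* A simple graph is a pair of a vertex set and a set of two-element edges. *)
type_synonym 'a ugraph = "'a set \<times> 'a set set"

abbreviation verts :: "'a ugraph \<Rightarrow> 'a set" where "verts G \<equiv> fst G"
abbreviation edges :: "'a ugraph \<Rightarrow> 'a set set" where "edges G \<equiv> snd G"

definition is_path :: "'a ugraph \<Rightarrow> 'a \<Rightarrow> 'a \<Rightarrow> 'a list \<Rightarrow> bool" where
  "is_path G u v xs \<longleftrightarrow>
     xs \<noteq> [] \<and> hd xs = u \<and> last xs = v \<and> set xs \<subseteq> verts G \<and> distinct xs \<and>
     successively (\<lambda>x y. {x, y} \<in> edges G) xs"

(* The infimum over the empty set is \<infinity>, so vertices in different components
   are at infinite distance. *)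
definition gdist :: "'a ugraph \<Rightarrow> 'a \<Rightarrow> 'a \<Rightarrow> enat" where
  "gdist G u v = (INF xs \<in> {xs. is_path G u v xs}. enat (length xs - 1))"

definition edge_dist :: "'a ugraph \<Rightarrow> 'a set \<Rightarrow> 'a \<Rightarrow> enat" where
  "edge_dist G e v = Min ((\<lambda>x. gdist G x v) ` e)"

(* The tuple (d(e,r_1), ..., d(e,r_k)) as a function on R, extensional outside R. *)
definition edge_dist_vec :: "'a ugraph \<Rightarrow> 'a set \<Rightarrow> 'a set \<Rightarrow> ('a \<Rightarrow> enat)" where
  "edge_dist_vec G R e = restrict (edge_dist G e) R"

definition edge_generating :: "'a ugraph \<Rightarrow> 'a set \<Rightarrow> bool" where
  "edge_generating G R \<longleftrightarrow>
     R \<subseteq> verts G \<and> finite R \<and>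
     (\<forall>e\<^sub>1\<in>edges G. \<forall>e\<^sub>2\<in>edges G.
        e\<^sub>1 \<noteq> e\<^sub>2 \<longrightarrow> edge_dist_vec G R e\<^sub>1 \<noteq> edge_dist_vec G R e\<^sub>2)"

definition edim :: "'a ugraph \<Rightarrow> nat" where
  "edim G = (LEAST k. \<exists>R. edge_generating G R \<and> card R = k)"

definition gnp :: "nat \<Rightarrow> real \<Rightarrow> nat ugraph pmf" where
  "gnp n p =
     map_pmf (\<lambda>X. ({..<n}, {e \<in> nsets {..<n} 2. X e}))
       (Pi_pmf (nsets {..<n} 2) False (\<lambda>_. bernoulli_pmf p))"

(* On finite simple graphs the minimum in edim is attained: the full vertex set
   is edge generating, since d(e,v) = 0 iff v is an endpoint of e. *)
lemma gdist_eq_0_iff: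
  assumes "u \<in> verts G"
  shows "gdist G u v = 0 \<longleftrightarrow> u = v"
proof
  assume "gdist G u v = 0"
  then have "{xs. is_path G u v xs} \<noteq> {}"
    by (force simp: gdist_def top_enat_def)
  then obtain ys where "is_path G u v ys"
    by blast
  then have "enat (length ys - 1) \<in> (\<lambda>xs. enat (length xs - 1)) ` {xs. is_path G u v xs}"
    by blast
  then have "(INF xs \<in> {xs. is_path G u v xs}. enat (length xs - 1))
      \<in> (\<lambda>xs. enat (length xs - 1)) ` {xs. is_path G u v xs}"
    by (rule wellorder_InfI)
  with \<open>gdist G u v = 0\<close> obtain xs where xs: "is_path G u v xs" "length xs - 1 = 0"
    by (auto simp: gdist_def zero_enat_def)
  then show "u = v"
    by (cases xs) (auto simp: is_path_def)
next
  assume "u = v"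
  then have "is_path G u v [u]"
    using assms by (auto simp: is_path_def)
  then have "gdist G u v \<le> enat (length [u] - 1)"
    unfolding gdist_def by (intro INF_lower) auto
  then show "gdist G u v = 0"
    by (simp add: zero_enat_def[symmetric])
qed

lemma edge_generating_verts:
  assumes "finite (verts G)" and "edges G \<subseteq> nsets (verts G) 2"
  shows "edge_generating G (verts G)"
proof -
  have zero: "edge_dist G e v = 0 \<longleftrightarrow> v \<in> e" if "e \<in> edges G" for e v
  proof -
    from that assms have e: "finite e" "e \<noteq> {}" "e \<subseteq> verts G"
      by (auto simp: nsets_def)
    have "edge_dist G e v = 0 \<longleftrightarrow> (\<exists>x\<in>e. gdist G x v = 0)"
      using e by (auto simp: edge_dist_def Min_eq_iff)
    also have "\<dots> \<longleftrightarrow> v \<in> e"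
      using e by (auto simp: gdist_eq_0_iff subset_iff)
    finally show ?thesis .
  qed
  have "e\<^sub>1 = e\<^sub>2"
    if e: "e\<^sub>1 \<in> edges G" "e\<^sub>2 \<in> edges G"
      and eq: "edge_dist_vec G (verts G) e\<^sub>1 = edge_dist_vec G (verts G) e\<^sub>2" for e\<^sub>1 e\<^sub>2
  proof -
    have "v \<in> e\<^sub>1 \<longleftrightarrow> v \<in> e\<^sub>2" if "v \<in> verts G" for v
      using fun_cong[OF eq, of v] that zero[OF e(1), of v] zero[OF e(2), of v]
      by (simp add: edge_dist_vec_def)
    moreover have "e\<^sub>1 \<subseteq> verts G" "e\<^sub>2 \<subseteq> verts G"
      using e assms(2) by (auto simp: nsets_def)
    ultimately show ?thesis by blast
  qed
  then show ?thesis
    using assms(1) by (auto simp: edge_generating_def)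
qed

end

theory Submission
  imports Defs "HOL-Real_Asymp.Real_Asymp"
begin

text \<open>
  Almost surely any two vertices of \<open>G(n,p)\<close> have a common neighbour. Then the distance from an edge
  \<open>xy\<close> to a vertex \<open>r\<close> outside it is 1 or 2, according to whether \<open>r\<close> is adjacent to \<open>x\<close> or \<open>y\<close>, and two disjoint
  edges avoiding \<open>R\<close> agree at a given \<open>r \<in> R\<close> with probability \<open>q\<close>. Fix \<open>R\<close> of size \<open>k\<close> and cut
  the remaining vertices into \<open>m \<approx> (log n)\<^sup>3\<close> blocks of four parts of \<open>b\<close> vertices. In each block
  count the quadruples \<open>(x, y, z, w)\<close>, one vertex per part, such that \<open>xy\<close> and \<open>zw\<close> are edges not
  separated by \<open>R\<close>. If \<open>b q\<^bsup>k/4\<^esup> \<ge> 1\<close>, the second moment of this count is at most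
  \<open>16 / p\<^sup>4\<close> times the square of its mean, so the count vanishes with probability at most
  \<open>1 - p\<^sup>4 / 16\<close>. The blocks are independent, hence \<open>R\<close> is edge generating with probability at most
  \<open>(1 - p\<^sup>4 / 16)\<^bsup>m\<^esup>\<close>, which beats the number \<open>n\<^bsup>O(log n)\<^esup>\<close> of sets \<open>R\<close>.
\<close>

subsection \<open>Independence in Bernoulli fields\<close>

text \<open>Independence is tracked through coordinate sets: functions depending on disjoint sets of
  coordinates of a product measure are independent, so no sigma-algebras need to be named.\<close>

definition depends_on :: "(('a \<Rightarrow> 'b) \<Rightarrow> 'c) \<Rightarrow> 'a set \<Rightarrow> bool" where
  "depends_on F D \<longleftrightarrow> (\<forall>X Y. (\<forall>x\<in>D. X x = Y x) \<longrightarrow> F X = F Y)"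

lemma depends_onI: "(\<And>X Y. (\<And>x. x \<in> D \<Longrightarrow> X x = Y x) \<Longrightarrow> F X = F Y) \<Longrightarrow> depends_on F D"
  unfolding depends_on_def by blast

lemma depends_onD: "depends_on F D \<Longrightarrow> (\<And>x. x \<in> D \<Longrightarrow> X x = Y x) \<Longrightarrow> F X = F Y"
  unfolding depends_on_def by blast

lemma depends_on_mono: "depends_on F D \<Longrightarrow> D \<subseteq> D' \<Longrightarrow> depends_on F D'"
  unfolding depends_on_def by blast

lemma depends_on_mult:
  fixes F G :: "('a \<Rightarrow> 'b) \<Rightarrow> real"
  assumes "depends_on F A" "depends_on G B"
  shows "depends_on (\<lambda>X. F X * G X) (A \<union> B)"
proof (rule depends_onI)
  fix X Y :: "'a \<Rightarrow> 'b" assume *: "\<And>x. x \<in> A \<union> B \<Longrightarrow> X x = Y x"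
  have "F X = F Y" by (rule depends_onD[OF assms(1)]) (use * in auto)
  moreover have "G X = G Y" by (rule depends_onD[OF assms(2)]) (use * in auto)
  ultimately show "F X * G X = F Y * G Y" by simp
qed

lemma depends_on_prod:
  fixes F :: "'l \<Rightarrow> ('a \<Rightarrow> 'b) \<Rightarrow> real"
  assumes "\<And>l. l \<in> L \<Longrightarrow> depends_on (F l) (D l)"
  shows "depends_on (\<lambda>X. \<Prod>l\<in>L. F l X) (\<Union>l\<in>L. D l)"
proof (rule depends_onI, rule prod.cong)
  fix X Y :: "'a \<Rightarrow> 'b" and l
  assume *: "\<And>x. x \<in> (\<Union>l\<in>L. D l) \<Longrightarrow> X x = Y x" and l: "l \<in> L"
  show "F l X = F l Y"
    using assms[OF l] by (rule depends_onD) (use * l in auto)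
qed simp

abbreviation bernoulli_field :: "'a set \<Rightarrow> real \<Rightarrow> ('a \<Rightarrow> bool) pmf" where
  "bernoulli_field I p \<equiv> Pi_pmf I False (\<lambda>_. bernoulli_pmf p)"

lemma finite_set_bernoulli_field:
  assumes "finite I"
  shows "finite (set_pmf (bernoulli_field I p))"
  by (rule finite_subset[OF set_Pi_pmf_subset'[OF assms]]) (use assms in auto)

lemma integrable_bernoulli_field [simp]:
  fixes F :: "('a \<Rightarrow> bool) \<Rightarrow> real"
  assumes "finite I"
  shows "integrable (measure_pmf (bernoulli_field I p)) F"
  by (rule integrable_measure_pmf_finite) (rule finite_set_bernoulli_field[OF assms])

text \<open>The field on \<open>I\<close> is the product of the fields on \<open>A\<close> and
  \<open>I - A\<close>. One factor of the integrand sees only the first component and the other only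
  the second, so the finite sum over pairs of configurations factorises.\<close>

lemma expectation_mult_depends_on:
  fixes F G :: "('a \<Rightarrow> bool) \<Rightarrow> real"
  assumes I: "finite I" "A \<subseteq> I" "B \<subseteq> I" "A \<inter> B = {}"
    and F: "depends_on F A" and G: "depends_on G B"
  shows "measure_pmf.expectation (bernoulli_field I p) (\<lambda>X. F X * G X) =
    measure_pmf.expectation (bernoulli_field I p) F * measure_pmf.expectation (bernoulli_field I p) G"
proof -
  let ?C = "I - A"
  have fin: "finite A" "finite ?C" using I by (auto intro: finite_subset)
  \<comment> \<open>\<open>B\<close> is enlarged to the full complement of \<open>A\<close>, so that
    two sets partition \<open>I\<close>.\<close>
  have G': "depends_on G ?C" using depends_on_mono[OF G] I by blast
  let ?P = "\<lambda>A. bernoulli_field A p"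
  \<comment> \<open>The field on \<open>D\<close> is a marginal of the field on \<open>I\<close>:
    coordinates outside \<open>D\<close> are reset to \<open>False\<close>, which \<open>H\<close>
    cannot notice. This returns both factors to the common field on \<open>I\<close>.\<close>
  have restr: "measure_pmf.expectation (?P I) H = measure_pmf.expectation (?P D) H"
    if "D \<subseteq> I" "depends_on H D" for H :: "('a \<Rightarrow> bool) \<Rightarrow> real" and D
  proof -
    have "H (\<lambda>x. if x \<in> D then X x else False) = H X" for X
      using that(2) by (rule depends_onD) simp
    then show ?thesis
      by (subst Pi_pmf_subset[OF I(1) that(1)]) simp
  qed
  have IA: "I = A \<union> ?C" using I by auto
  have "measure_pmf.expectation (?P I) (\<lambda>X. F X * G X) =
      measure_pmf.expectation (pair_pmf (?P A) (?P ?C))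
        (\<lambda>(f, g). F (\<lambda>x. if x \<in> A then f x else g x) * G (\<lambda>x. if x \<in> A then f x else g x))"
    by (subst IA, subst Pi_pmf_union[OF fin], simp, unfold integral_map_pmf)
       (rule Bochner_Integration.integral_cong, auto)
  also have "\<dots> = measure_pmf.expectation (pair_pmf (?P A) (?P ?C)) (\<lambda>(f, g). F f * G g)"
  proof (intro arg_cong[where f = "measure_pmf.expectation _"] ext, clarify)
    fix f g :: "'a \<Rightarrow> bool"
    have "F (\<lambda>x. if x \<in> A then f x else g x) = F f"
      using F by (rule depends_onD) auto
    moreover have "G (\<lambda>x. if x \<in> A then f x else g x) = G g"
      using G' by (rule depends_onD) auto
    ultimately show "F (\<lambda>x. if x \<in> A then f x else g x) * G (\<lambda>x. if x \<in> A then f x else g x) = F f * G g"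
      by simp
  qed
  also have "\<dots> = (\<Sum>(f, g)\<in>set_pmf (?P A) \<times> set_pmf (?P ?C). F f * G g * (pmf (?P A) f * pmf (?P ?C) g))"
    by (subst integral_measure_pmf_real[where A = "set_pmf (?P A) \<times> set_pmf (?P ?C)"])
       (use finite_set_bernoulli_field[OF fin(1)] finite_set_bernoulli_field[OF fin(2)]
        in \<open>auto simp: pmf_pair intro!: sum.cong\<close>)
  also have "\<dots> = (\<Sum>f\<in>set_pmf (?P A). F f * pmf (?P A) f) * (\<Sum>g\<in>set_pmf (?P ?C). G g * pmf (?P ?C) g)"
    by (simp add: sum_product sum.cartesian_product mult_ac case_prod_beta)
  also have "\<dots> = measure_pmf.expectation (?P A) F * measure_pmf.expectation (?P ?C) G"
    using finite_set_bernoulli_field[OF fin(1)] finite_set_bernoulli_field[OF fin(2)]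
    by (subst (1 2) integral_measure_pmf_real) auto
  also have "\<dots> = measure_pmf.expectation (?P I) F * measure_pmf.expectation (?P I) G"
    using restr[OF I(2) F] restr[OF _ G'] by simp
  finally show ?thesis .
qed

lemma expectation_prod_depends_on:
  fixes F :: "'l \<Rightarrow> ('a \<Rightarrow> bool) \<Rightarrow> real"
  assumes I: "finite I" and L: "finite L" and D: "\<And>l. l \<in> L \<Longrightarrow> D l \<subseteq> I" "disjoint_family_on D L"
    and F: "\<And>l. l \<in> L \<Longrightarrow> depends_on (F l) (D l)"
  shows "measure_pmf.expectation (bernoulli_field I p) (\<lambda>X. \<Prod>l\<in>L. F l X) =
    (\<Prod>l\<in>L. measure_pmf.expectation (bernoulli_field I p) (F l))"
  using L D F
proof (induction L)
  case empty
  then show ?case by simp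
next
  case (insert l L)
  have "measure_pmf.expectation (bernoulli_field I p) (\<lambda>X. F l X * (\<Prod>l\<in>L. F l X)) =
    measure_pmf.expectation (bernoulli_field I p) (F l) *
    measure_pmf.expectation (bernoulli_field I p) (\<lambda>X. \<Prod>l\<in>L. F l X)"
  proof (rule expectation_mult_depends_on[OF I])
    show "D l \<inter> (\<Union>l\<in>L. D l) = {}"
      using insert.prems(2) insert.hyps by (auto simp: disjoint_family_on_def)
    show "depends_on (\<lambda>X. \<Prod>l\<in>L. F l X) (\<Union>l\<in>L. D l)"
      using insert.prems by (intro depends_on_prod) auto
  qed (use insert.prems in auto)
  moreover have "disjoint_family_on D L"
    using insert.prems(2) by (auto simp: disjoint_family_on_def)
  ultimately show ?case
    using insert by simp
qed

lemma expectation_of_bool: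
  "measure_pmf.expectation M (\<lambda>x. of_bool (P x)) = measure_pmf.prob M {x. P x}"
proof -
  have "(\<lambda>x. of_bool (P x)) = (indicator {x. P x} :: 'a \<Rightarrow> real)"
    by (auto simp: indicator_def)
  then show ?thesis by simp
qed

lemma expectation_bernoulli_field_component:
  assumes "finite I" "e \<in> I" "0 \<le> p" "p \<le> 1"
  shows "measure_pmf.expectation (bernoulli_field I p) (\<lambda>X. of_bool (X e)) = p"
    and "measure_pmf.expectation (bernoulli_field I p) (\<lambda>X. of_bool (\<not> X e)) = 1 - p"
proof -
  have *: "measure_pmf.expectation (bernoulli_field I p) (\<lambda>X. f (X e)) =
      measure_pmf.expectation (bernoulli_pmf p) f" for f :: "bool \<Rightarrow> real"
  proof -
    have "map_pmf (\<lambda>f. f e) (bernoulli_field I p) = bernoulli_pmf p"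
      using assms by (simp add: Pi_pmf_component)
    then show ?thesis by (metis integral_map_pmf)
  qed
  show "measure_pmf.expectation (bernoulli_field I p) (\<lambda>X. of_bool (X e)) = p"
    using assms by (subst *) simp
  show "measure_pmf.expectation (bernoulli_field I p) (\<lambda>X. of_bool (\<not> X e)) = 1 - p"
    using assms by (subst *[where f = "\<lambda>b. of_bool (\<not> b)"]) simp
qed

lemma expectation_all_false:
  assumes I: "finite I" "D \<subseteq> I" and p: "0 \<le> p" "p \<le> 1"
  shows "measure_pmf.expectation (bernoulli_field I p) (\<lambda>X. \<Prod>e\<in>D. of_bool (\<not> X e)) = (1 - p) ^ card D"
proof -
  have "finite D" using I finite_subset by blast
  then have "measure_pmf.expectation (bernoulli_field I p) (\<lambda>X. \<Prod>e\<in>D. of_bool (\<not> X e) :: real) =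
     (\<Prod>e\<in>D. measure_pmf.expectation (bernoulli_field I p) (\<lambda>X. of_bool (\<not> X e)))"
    using I
    by (intro expectation_prod_depends_on[where D = "\<lambda>e. {e}" and F = "\<lambda>e X. of_bool (\<not> X e)"])
      (auto simp: disjoint_family_on_def depends_on_def)
  also have "\<dots> = (\<Prod>e\<in>D. 1 - p)"
    using I p by (intro prod.cong) (auto simp: expectation_bernoulli_field_component)
  finally show ?thesis by simp
qed

text \<open>Cauchy-Schwarz applied to \<open>F = F * of_bool (F \<noteq> 0)\<close>, with the square
  root of the point mass attached to each factor.\<close>

lemma prob_neq_0_ge_second_moment:
  fixes F :: "('a \<Rightarrow> bool) \<Rightarrow> real"
  assumes "finite I"
  shows "(measure_pmf.expectation (bernoulli_field I p) F)\<^sup>2 \<le>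
    measure_pmf.expectation (bernoulli_field I p) (\<lambda>X. (F X)\<^sup>2) *
    measure_pmf.prob (bernoulli_field I p) {X. F X \<noteq> 0}"
proof -
  let ?P = "bernoulli_field I p"
  let ?E = "measure_pmf.expectation ?P"
  let ?S = "set_pmf ?P"
  note fin = finite_set_bernoulli_field[OF assms, of p]
  have E: "?E H = (\<Sum>X\<in>?S. H X * pmf ?P X)" for H :: "_ \<Rightarrow> real"
    using fin by (subst integral_measure_pmf_real[of ?S]) auto
  have "(\<Sum>X\<in>?S. (F X * sqrt (pmf ?P X)) * (of_bool (F X \<noteq> 0) * sqrt (pmf ?P X)))\<^sup>2 \<le>
    (\<Sum>X\<in>?S. (F X * sqrt (pmf ?P X))\<^sup>2) * (\<Sum>X\<in>?S. (of_bool (F X \<noteq> 0) * sqrt (pmf ?P X))\<^sup>2)"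
    by (rule Cauchy_Schwarz_ineq_sum)
  also have "(\<Sum>X\<in>?S. (F X * sqrt (pmf ?P X)) * (of_bool (F X \<noteq> 0) * sqrt (pmf ?P X))) = ?E F"
    unfolding E by (intro sum.cong) auto
  also have "(\<Sum>X\<in>?S. (F X * sqrt (pmf ?P X))\<^sup>2) = ?E (\<lambda>X. (F X)\<^sup>2)"
    unfolding E by (intro sum.cong) (auto simp: power_mult_distrib)
  also have "(\<Sum>X\<in>?S. (of_bool (F X \<noteq> 0) * sqrt (pmf ?P X))\<^sup>2) = ?E (\<lambda>X. of_bool (F X \<noteq> 0))"
    unfolding E by (intro sum.cong) (auto simp: power_mult_distrib)
  finally show ?thesis by (simp add: expectation_of_bool)
qed


subsection \<open>Collisions in one block\<close>

text \<open>Let \<open>A\<close>, \<open>A'\<close> be indicators with mean \<open>z\<close> and \<open>E A A' = a\<close>, and \<open>B\<close>, \<open>B'\<close> independent of them,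
  with mean \<open>z\<close> and \<open>E B B' = b\<close>. Then \<open>match_form z a b\<close> is the probability that \<open>A = B\<close> and \<open>A' = B'\<close>.\<close>

definition match_form :: "real \<Rightarrow> real \<Rightarrow> real \<Rightarrow> real" where
  "match_form z a b = a * b + 2 * (z - a) * (z - b) + (1 - 2 * z + a) * (1 - 2 * z + b)"

text \<open>\<open>match_form z a b\<close> is the inner product of
  \<open>(a, z - a, z - a, 1 - 2z + a)\<close> with the same vector for \<open>b\<close>. The sum of
  squares in the proof is Lagrange's identity; the repeated middle entry produces the factors
  2.\<close>

lemma match_form_Cauchy_Schwarz: "(match_form z a b)\<^sup>2 \<le> match_form z a a * match_form z b b"
proof -
  have "match_form z a a * match_form z b b - (match_form z a b)\<^sup>2 =
    2 * (a * (z - b) - b * (z - a))\<^sup>2 + (a * (1 - 2 * z + b) - b * (1 - 2 * z + a))\<^sup>2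
    + 2 * ((z - a) * (1 - 2 * z + b) - (z - b) * (1 - 2 * z + a))\<^sup>2"
    unfolding match_form_def by algebra
  moreover have "\<dots> \<ge> 0" by (intro add_nonneg_nonneg mult_nonneg_nonneg) auto
  ultimately show ?thesis by linarith
qed

lemma match_form_diag_nonneg: "0 \<le> match_form z a a"
  unfolding match_form_def mult.assoc by (intro add_nonneg_nonneg mult_nonneg_nonneg zero_le_square) simp

text \<open>Here \<open>s\<close> stands for \<open>1 - p\<close>, and
  \<open>q * \<theta> ^ j\<close> is q to the power 1 - j/4. Two choices sharing \<open>j\<close> of
  the two positions in each half have \<open>4 - j\<close> distinct coordinates per half. The bound
  is an equality for \<open>j = 0\<close> (independent choices) and \<open>j = 2\<close> (equal
  choices). For \<open>j = 1\<close>, squaring once more removes \<theta> and leaves a polynomial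
  inequality in \<open>s\<close>.\<close>

lemma match_form_diag_le:
  fixes s \<theta> q :: real
  assumes s: "0 \<le> s" "s \<le> 1" and q: "q = 1 - 2 * s\<^sup>2 + 2 * s ^ 4" and \<theta>: "\<theta> > 0" "\<theta> ^ 4 * q = 1"
    and j: "j \<le> 2"
  shows "match_form (s\<^sup>2) (s ^ (4 - j)) (s ^ (4 - j)) \<le> (q * \<theta> ^ j)\<^sup>2"
proof -
  consider "j = 0" | "j = 1" | "j = 2" using j by linarith
  then show ?thesis
  proof cases
    case 1
    have "match_form (s\<^sup>2) (s ^ 4) (s ^ 4) = q\<^sup>2"
      unfolding match_form_def q by algebra
    then show ?thesis using 1 by simp
  next
    case 3
    have "match_form (s\<^sup>2) (s\<^sup>2) (s\<^sup>2) = q"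
      unfolding match_form_def q by algebra
    also have "q = (q * \<theta>\<^sup>2)\<^sup>2" using \<theta>(2) by algebra
    finally show ?thesis using 3 by simp
  next
    case 2
    define t where "t = 1 - s"
    have t: "t \<ge> 0" "s = 1 - t" using s by (auto simp: t_def)
    define Q where "Q = match_form (s\<^sup>2) (s ^ 3) (s ^ 3)"
    have Q: "Q = 1 - 4 * s^2 + 2 * s^3 + 6 * s^4 - 8 * s^5 + 4 * s^6"
      unfolding match_form_def Q_def by algebra
    \<comment> \<open>The cofactor is a Bernstein expansion, whose coefficients happen to be nonnegative.\<close>
    have "q ^ 3 - Q\<^sup>2 = s\<^sup>2 * t\<^sup>2 * (2 * t^8 + 16 * t^7 * s + 44 * t^6 * s^2 + 48 * t^5 * s^3
        + 32 * t^4 * s^4 + 48 * t^3 * s^5 + 20 * t^2 * s^6 + 6 * s^8)"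
      unfolding Q q t_def by algebra
    also have "\<dots> \<ge> 0" using s t by simp
    finally have "Q\<^sup>2 \<le> q ^ 3" by simp
    also have "\<dots> = ((q * \<theta>)\<^sup>2)\<^sup>2" using \<theta>(2) by algebra
    finally have "Q \<le> (q * \<theta>)\<^sup>2" by (rule power2_le_imp_le) simp
    then show ?thesis using 2 by (simp add: Q_def)
  qed
qed

text \<open>Cauchy-Schwarz reduces unequal overlaps \<open>i\<close> and \<open>j\<close> in the two
  halves to the diagonal. Since only \<open>i + j\<close> enters the exponent, each shared position
  costs one factor \<theta>, whichever half it lies in.\<close>

lemma match_form_le:
  fixes s \<theta> q :: real
  assumes s: "0 \<le> s" "s \<le> 1" and q: "q = 1 - 2 * s\<^sup>2 + 2 * s ^ 4" and \<theta>: "\<theta> > 0" "\<theta> ^ 4 * q = 1"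
    and "i \<le> 2" "j \<le> 2"
  shows "match_form (s\<^sup>2) (s ^ (4 - i)) (s ^ (4 - j)) \<le> q\<^sup>2 * \<theta> ^ (i + j)"
proof (rule power2_le_imp_le)
  have "q > 0" using \<theta> by (metis zero_less_mult_pos zero_less_one zero_less_power)
  then show "0 \<le> q\<^sup>2 * \<theta> ^ (i + j)" using \<theta> by simp
  have "(match_form (s\<^sup>2) (s ^ (4 - i)) (s ^ (4 - j)))\<^sup>2 \<le>
     match_form (s\<^sup>2) (s ^ (4 - i)) (s ^ (4 - i)) * match_form (s\<^sup>2) (s ^ (4 - j)) (s ^ (4 - j))"
    by (rule match_form_Cauchy_Schwarz)
  also have "\<dots> \<le> (q * \<theta> ^ i)\<^sup>2 * (q * \<theta> ^ j)\<^sup>2"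
    using assms by (intro mult_mono match_form_diag_le) (auto simp: match_form_diag_nonneg)
  also have "\<dots> = (q\<^sup>2 * \<theta> ^ (i + j))\<^sup>2"
    by (simp add: power_mult_distrib power_add)
  finally show "(match_form (s\<^sup>2) (s ^ (4 - i)) (s ^ (4 - j)))\<^sup>2 \<le> (q\<^sup>2 * \<theta> ^ (i + j))\<^sup>2" .
qed

section \<open>The law of one and of two matching tests\<close>

lemma of_bool_Ball:
  assumes "finite R"
  shows "of_bool (\<forall>x\<in>R. P x) = (\<Prod>x\<in>R. of_bool (P x) :: real)"
  using assms by (induction R) auto

lemma prob_Collect_not: "measure_pmf.prob M {x. \<not> P x} = 1 - measure_pmf.prob M {x. P x}"
  using measure_pmf.prob_compl[of "{x. P x}" M] by (simp add: Collect_neg_eq Compl_eq_Diff_UNIV)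

text \<open>The four entries are meant to be the pairs \<open>xr\<close>, \<open>yr\<close>,
  \<open>zr\<close>, \<open>wr\<close>; the test then says that \<open>r\<close> does not separate
  \<open>xy\<close> from \<open>zw\<close>. Indexing by position lets overlaps be counted position
  by position.\<close>

definition or_match :: "('a \<Rightarrow> bool) \<Rightarrow> (nat \<Rightarrow> 'a) \<Rightarrow> bool" where
  "or_match X e \<longleftrightarrow> (X (e 0) \<or> X (e 1)) = (X (e 2) \<or> X (e 3))"

text \<open>Negating both sides of a test turns it into equality of two "all false" indicators, one
  per half. The product of two tests expands into four terms. The halves use disjoint coordinates,
  so each term factorises, and the result is \<open>match_form\<close>. Overlap of \<open>e\<close>
  and \<open>f\<close> inside a half is allowed and enters through the cardinalities.\<close>

lemma expectation_or_match_pair: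
  fixes e f :: "nat \<Rightarrow> 'a"
  assumes I: "finite I" and p: "0 \<le> p" "p \<le> 1"
    and sub: "{e 0, e 1, f 0, f 1} \<subseteq> I" "{e 2, e 3, f 2, f 3} \<subseteq> I"
    and disj: "{e 0, e 1, f 0, f 1} \<inter> {e 2, e 3, f 2, f 3} = {}"
    and neq: "e 0 \<noteq> e 1" "f 0 \<noteq> f 1" "e 2 \<noteq> e 3" "f 2 \<noteq> f 3"
  shows "measure_pmf.expectation (bernoulli_field I p) (\<lambda>X. of_bool (or_match X e) * of_bool (or_match X f)) =
    match_form ((1 - p)\<^sup>2) ((1 - p) ^ card {e 0, e 1, f 0, f 1}) ((1 - p) ^ card {e 2, e 3, f 2, f 3})"
proof -
  let ?E = "measure_pmf.expectation (bernoulli_field I p)"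
  \<comment> \<open>Indicator that all coordinates in \<open>D\<close> are false. Products
    correspond to unions, so joint moments depend only on the number of distinct
    coordinates.\<close>
  define N :: "'a set \<Rightarrow> ('a \<Rightarrow> bool) \<Rightarrow> real" where "N D X = (\<Prod>x\<in>D. of_bool (\<not> X x))" for D X
  have EN: "?E (N D) = (1 - p) ^ card D" if "D \<subseteq> I" for D
    unfolding N_def by (rule expectation_all_false[OF I that p])
  have N_mult: "N C X * N D X = N (C \<union> D) X" if "finite C" "finite D" for C D X
    using that by (auto simp: N_def of_bool_Ball[symmetric])
  have dep: "depends_on (N D) C" if "D \<subseteq> C" for C D
    unfolding N_def by (rule depends_onI) (use that in \<open>auto intro!: prod.cong\<close>)
  define A A' B B' where defs: "A = N {e 0, e 1}" "A' = N {f 0, f 1}" "B = N {e 2, e 3}" "B' = N {f 2, f 3}"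
  let ?D = "{e 0, e 1, f 0, f 1}" and ?D' = "{e 2, e 3, f 2, f 3}"
  have E1: "?E A = (1 - p)\<^sup>2" "?E A' = (1 - p)\<^sup>2" "?E B = (1 - p)\<^sup>2" "?E B' = (1 - p)\<^sup>2"
    using sub neq by (auto simp: EN defs power2_eq_square)
  have E2: "?E (\<lambda>X. A X * A' X) = (1 - p) ^ card ?D" "?E (\<lambda>X. B X * B' X) = (1 - p) ^ card ?D'"
    using sub by (simp_all add: EN defs N_mult insert_commute)
  have dA: "depends_on A ?D" "depends_on A' ?D" and dB: "depends_on B ?D'" "depends_on B' ?D'"
    by (auto simp: defs intro!: dep)
  have split: "?E (\<lambda>X. g (A X) (A' X) * h (B X) (B' X)) =
      ?E (\<lambda>X. g (A X) (A' X)) * ?E (\<lambda>X. h (B X) (B' X))" for g h :: "real \<Rightarrow> real \<Rightarrow> real"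
  proof (rule expectation_mult_depends_on[OF I sub disj])
    show "depends_on (\<lambda>X. g (A X) (A' X)) ?D"
      using dA unfolding depends_on_def by metis
    show "depends_on (\<lambda>X. h (B X) (B' X)) ?D'"
      using dB unfolding depends_on_def by metis
  qed
  have int: "integrable (measure_pmf (bernoulli_field I p)) F" for F :: "('a \<Rightarrow> bool) \<Rightarrow> real"
    by (rule integrable_bernoulli_field[OF I])
  have EA: "?E (\<lambda>X. A X * (1 - A' X)) = (1 - p)\<^sup>2 - (1 - p) ^ card ?D"
    "?E (\<lambda>X. (1 - A X) * A' X) = (1 - p)\<^sup>2 - (1 - p) ^ card ?D"
    "?E (\<lambda>X. (1 - A X) * (1 - A' X)) = 1 - 2 * (1 - p)\<^sup>2 + (1 - p) ^ card ?D"
    by (simp_all add: left_diff_distrib right_diff_distrib Bochner_Integration.integral_diff[OF int int]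
        E1 E2)
  have EB: "?E (\<lambda>X. B X * (1 - B' X)) = (1 - p)\<^sup>2 - (1 - p) ^ card ?D'"
    "?E (\<lambda>X. (1 - B X) * B' X) = (1 - p)\<^sup>2 - (1 - p) ^ card ?D'"
    "?E (\<lambda>X. (1 - B X) * (1 - B' X)) = 1 - 2 * (1 - p)\<^sup>2 + (1 - p) ^ card ?D'"
    by (simp_all add: left_diff_distrib right_diff_distrib Bochner_Integration.integral_diff[OF int int]
        E1 E2)
  have "of_bool (or_match X e) * of_bool (or_match X f) =
      (A X * A' X) * (B X * B' X) + (A X * (1 - A' X)) * (B X * (1 - B' X))
      + ((1 - A X) * A' X) * ((1 - B X) * B' X) + ((1 - A X) * (1 - A' X)) * ((1 - B X) * (1 - B' X))" for X
  proof -
    have "of_bool (or_match X e) = A X * B X + (1 - A X) * (1 - B X)"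
      using neq by (auto simp: defs N_def or_match_def)
    moreover have "of_bool (or_match X f) = A' X * B' X + (1 - A' X) * (1 - B' X)"
      using neq by (auto simp: defs N_def or_match_def)
    ultimately have "of_bool (or_match X e) * of_bool (or_match X f) =
        (A X * B X + (1 - A X) * (1 - B X)) * (A' X * B' X + (1 - A' X) * (1 - B' X))"
      by (simp only:)
    then show ?thesis by (simp only: algebra_simps)
  qed
  then have "?E (\<lambda>X. of_bool (or_match X e) * of_bool (or_match X f)) =
      ?E (\<lambda>X. (A X * A' X) * (B X * B' X)) + ?E (\<lambda>X. (A X * (1 - A' X)) * (B X * (1 - B' X)))
      + ?E (\<lambda>X. ((1 - A X) * A' X) * ((1 - B X) * B' X))
      + ?E (\<lambda>X. ((1 - A X) * (1 - A' X)) * ((1 - B X) * (1 - B' X)))"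
    by (simp only: Bochner_Integration.integral_add[OF int int])
  also have "\<dots> = match_form ((1 - p)\<^sup>2) ((1 - p) ^ card ?D) ((1 - p) ^ card ?D')"
    unfolding split[of "\<lambda>a b. a * b" "\<lambda>a b. a * b"]
      split[of "\<lambda>a b. a * (1 - b)" "\<lambda>a b. a * (1 - b)"]
      split[of "\<lambda>a b. (1 - a) * b" "\<lambda>a b. (1 - a) * b"]
      split[of "\<lambda>a b. (1 - a) * (1 - b)" "\<lambda>a b. (1 - a) * (1 - b)"] EA EB E2 match_form_def
    by (simp add: algebra_simps)
  finally show ?thesis .
qed

text \<open>The pair formula with both tests equal, since an indicator is its own square.\<close>

lemma expectation_or_match:
  fixes e :: "nat \<Rightarrow> 'a"
  assumes I: "finite I" and p: "0 \<le> p" "p \<le> 1"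
    and e: "inj_on e {..<4}" "e ` {..<4} \<subseteq> I"
  shows "measure_pmf.expectation (bernoulli_field I p) (\<lambda>X. of_bool (or_match X e)) =
    1 - 2 * (1 - p)\<^sup>2 + 2 * (1 - p) ^ 4"
proof -
  have neq: "e i \<noteq> e j" if "i < 4" "j < 4" "i \<noteq> j" for i j
    using that e(1) by (auto simp: inj_on_def)
  have "measure_pmf.expectation (bernoulli_field I p) (\<lambda>X. of_bool (or_match X e) * of_bool (or_match X e)) =
    match_form ((1 - p)\<^sup>2) ((1 - p) ^ card {e 0, e 1, e 0, e 1}) ((1 - p) ^ card {e 2, e 3, e 2, e 3})"
    by (rule expectation_or_match_pair[OF I p]) (use e(2) in \<open>auto simp: neq\<close>)
  also have "card {e 0, e 1, e 0, e 1} = 2" by (auto simp: neq insert_commute)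
  also have "card {e 2, e 3, e 2, e 3} = 2" by (auto simp: neq insert_commute)
  also have "match_form ((1 - p)\<^sup>2) ((1 - p)\<^sup>2) ((1 - p)\<^sup>2) = 1 - 2 * (1 - p)\<^sup>2 + 2 * (1 - p) ^ 4"
    unfolding match_form_def by algebra
  finally show ?thesis by (simp flip: of_bool_conj)
qed

text \<open>Paley--Zygmund for the number of good \<open>\<tau>\<close>. A column of two choices overlapping in \<open>j\<close> of the four
  positions costs at most \<open>q\<^sup>2 \<theta>\<^sup>j\<close>, so the second moment factorises over the positions.\<close>

lemma block_failure_prob:
  fixes \<sigma> :: "nat \<Rightarrow> nat \<Rightarrow> 'r \<Rightarrow> 'a" and \<eta> \<eta>' :: "nat \<Rightarrow> nat \<Rightarrow> 'a"
  assumes I: "finite I" and R: "finite R" and p: "0 < p" "p < 1"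
    and q: "q = 1 - 2 * (1 - p)\<^sup>2 + 2 * (1 - p) ^ 4" and \<theta>: "\<theta> > 0" "\<theta> ^ 4 * q = 1"
    and b: "\<theta> ^ card R \<le> real b"
    and \<sigma>: "\<And>i a r. i < 4 \<Longrightarrow> a < b \<Longrightarrow> r \<in> R \<Longrightarrow> \<sigma> i a r \<in> I"
    and \<sigma>_eq: "\<And>i a r j c t. i < 4 \<Longrightarrow> a < b \<Longrightarrow> r \<in> R \<Longrightarrow> j < 4 \<Longrightarrow> c < b \<Longrightarrow> t \<in> R \<Longrightarrow>
       \<sigma> i a r = \<sigma> j c t \<longleftrightarrow> i = j \<and> a = c \<and> r = t"
    and \<eta>: "\<And>a c. a < b \<Longrightarrow> c < b \<Longrightarrow> \<eta> a c \<in> I" "\<And>a c. a < b \<Longrightarrow> c < b \<Longrightarrow> \<eta>' a c \<in> I"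
    and \<eta>_neq: "\<And>a c a' c'. a < b \<Longrightarrow> c < b \<Longrightarrow> a' < b \<Longrightarrow> c' < b \<Longrightarrow> \<eta> a c \<noteq> \<eta>' a' c'"
      "\<And>a c i d r. a < b \<Longrightarrow> c < b \<Longrightarrow> i < 4 \<Longrightarrow> d < b \<Longrightarrow> r \<in> R \<Longrightarrow> \<eta> a c \<noteq> \<sigma> i d r"
      "\<And>a c i d r. a < b \<Longrightarrow> c < b \<Longrightarrow> i < 4 \<Longrightarrow> d < b \<Longrightarrow> r \<in> R \<Longrightarrow> \<eta>' a c \<noteq> \<sigma> i d r"
  shows "measure_pmf.prob (bernoulli_field I p)
    {X. \<not> (\<exists>\<tau>\<in>{..<4} \<rightarrow>\<^sub>E {..<b}. X (\<eta> (\<tau> 0) (\<tau> 1)) \<and> X (\<eta>' (\<tau> 2) (\<tau> 3)) \<and>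
        (\<forall>r\<in>R. or_match X (\<lambda>i. \<sigma> i (\<tau> i) r)))} \<le> 1 - p ^ 4 / 16"
proof -
  let ?P = "bernoulli_field I p"
  let ?E = "measure_pmf.expectation ?P"
  define T where "T = {..<4::nat} \<rightarrow>\<^sub>E {..<b}"
  define k where "k = card R"
  have finT: "finite T" and cardT: "card T = b ^ 4"
    by (auto simp: T_def card_PiE finite_PiE)
  have T: "\<tau> i < b" if "\<tau> \<in> T" "i < 4" for \<tau> i
    using that by (auto simp: T_def PiE_def Pi_def)
  have T4: "\<tau> 0 < b" "\<tau> 1 < b" "\<tau> 2 < b" "\<tau> 3 < b" if "\<tau> \<in> T" for \<tau>
    using T[OF that] by auto
  have q0: "q > 0" using \<theta> by (metis zero_less_mult_pos zero_less_one zero_less_power)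
  have b0: "real b > 0" using b \<theta>(1) by (meson less_le_trans zero_less_power)
  have p': "0 \<le> p" "p \<le> 1" using p by auto
  define col where "col \<tau> r = (\<lambda>i. \<sigma> i (\<tau> i) r)" for \<tau> :: "nat \<Rightarrow> nat" and r
  define M :: "(nat \<Rightarrow> nat) \<Rightarrow> ('a \<Rightarrow> bool) \<Rightarrow> real" where
    "M \<tau> X = (\<Prod>r\<in>R. of_bool (or_match X (col \<tau> r)))" for \<tau> X
  \<comment> \<open>The number of good quadruples in the block: two edge indicators times the event
    \<open>M\<close> that no \<open>r\<close> separates them.\<close>
  define Z :: "('a \<Rightarrow> bool) \<Rightarrow> real" where
    "Z X = (\<Sum>\<tau>\<in>T. of_bool (X (\<eta> (\<tau> 0) (\<tau> 1))) * (of_bool (X (\<eta>' (\<tau> 2) (\<tau> 3))) * M \<tau> X))" for X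
  let ?D = "\<lambda>\<tau> r. col \<tau> r ` {..<4}"
  have DI: "?D \<tau> r \<subseteq> I" if "\<tau> \<in> T" "r \<in> R" for \<tau> r
    using that T by (auto simp: col_def intro!: \<sigma>)
  have dep: "depends_on (\<lambda>X. of_bool (or_match X (col \<tau> r)) :: real) (?D \<tau> r)" for \<tau> r
  proof (rule depends_onI)
    fix X Y :: "'a \<Rightarrow> bool" assume "\<And>x. x \<in> ?D \<tau> r \<Longrightarrow> X x = Y x"
    then have "X (col \<tau> r i) = Y (col \<tau> r i)" if "i < 4" for i using that by simp
    then show "(of_bool (or_match X (col \<tau> r)) :: real) = of_bool (or_match Y (col \<tau> r))"
      by (simp add: or_match_def)
  qed
  have EM: "?E (M \<tau>) = q ^ k" if \<tau>: "\<tau> \<in> T" for \<tau>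
  proof -
    have "?E (M \<tau>) = (\<Prod>r\<in>R. ?E (\<lambda>X. of_bool (or_match X (col \<tau> r))))"
      unfolding M_def
      by (rule expectation_prod_depends_on[OF I R, where D = "?D \<tau>"])
         (use DI[OF \<tau>] dep T[OF \<tau>] \<sigma>_eq in \<open>auto simp: disjoint_family_on_def col_def\<close>)
    also have "\<dots> = (\<Prod>r\<in>R. q)"
    proof (rule prod.cong[OF refl])
      fix r assume r: "r \<in> R"
      have "inj_on (col \<tau> r) {..<4}"
        using T[OF \<tau>] \<sigma>_eq r by (auto simp: inj_on_def col_def)
      then show "?E (\<lambda>X. of_bool (or_match X (col \<tau> r))) = q"
        unfolding q by (rule expectation_or_match[OF I p' _ DI[OF \<tau> r]])
    qed
    finally show ?thesis by (simp add: k_def)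
  qed
  \<comment> \<open>The two edge coordinates differ from each other and from all coordinates used by
    \<open>M\<close>, so the three factors are independent.\<close>
  have EZ: "?E Z = real b ^ 4 * (p\<^sup>2 * q ^ k)"
  proof -
    have "?E Z = (\<Sum>\<tau>\<in>T. ?E (\<lambda>X. of_bool (X (\<eta> (\<tau> 0) (\<tau> 1))) * (of_bool (X (\<eta>' (\<tau> 2) (\<tau> 3))) * M \<tau> X)))"
      unfolding Z_def by (rule Bochner_Integration.integral_sum) (simp add: I)
    also have "\<dots> = (\<Sum>\<tau>\<in>T. p * (p * q ^ k))"
    proof (rule sum.cong[OF refl])
      fix \<tau> assume \<tau>: "\<tau> \<in> T"
      let ?C = "\<Union>r\<in>R. ?D \<tau> r"
      let ?x = "\<eta> (\<tau> 0) (\<tau> 1)" and ?y = "\<eta>' (\<tau> 2) (\<tau> 3)"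
      have M: "depends_on (M \<tau>) ?C"
        unfolding M_def by (rule depends_on_prod) (rule dep)
      have C: "?C \<subseteq> I" "?x \<notin> ?C" "?y \<notin> ?C" "?x \<noteq> ?y" "?x \<in> I" "?y \<in> I"
        using DI[OF \<tau>] T[OF \<tau>] T4[OF \<tau>] \<eta> \<eta>_neq by (auto simp: col_def)
      have one: "depends_on (\<lambda>X. of_bool (X x) :: real) {x}" for x :: 'a
        by (auto simp: depends_on_def)
      have "?E (\<lambda>X. of_bool (X ?x) * (of_bool (X ?y) * M \<tau> X)) =
          ?E (\<lambda>X. of_bool (X ?x)) * ?E (\<lambda>X. of_bool (X ?y) * M \<tau> X)"
      proof (rule expectation_mult_depends_on[OF I _ _ _ one])
        show "depends_on (\<lambda>X. of_bool (X ?y) * M \<tau> X) ({?y} \<union> ?C)"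
          by (rule depends_on_mult[OF one M])
      qed (use C in auto)
      also have "?E (\<lambda>X. of_bool (X ?y) * M \<tau> X) = ?E (\<lambda>X. of_bool (X ?y)) * ?E (M \<tau>)"
        by (rule expectation_mult_depends_on[OF I _ _ _ one M]) (use C in auto)
      finally show "?E (\<lambda>X. of_bool (X ?x) * (of_bool (X ?y) * M \<tau> X)) = p * (p * q ^ k)"
        using C p' I EM[OF \<tau>] by (simp add: expectation_bernoulli_field_component del: of_bool_eq)
    qed
    finally show ?thesis by (simp add: cardT power2_eq_square)
  qed
  \<comment> \<open>Writes \<theta> to the number of agreements of the two choices as a product over
    positions.\<close>
  define w where "w \<tau> \<tau>' i = (if \<tau> i = \<tau>' i then \<theta> else 1)" for \<tau> \<tau>' :: "nat \<Rightarrow> nat" and i :: nat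
  have EMM: "?E (\<lambda>X. M \<tau> X * M \<tau>' X) \<le> q ^ (2 * k) * (\<Prod>i<4. w \<tau> \<tau>' i ^ k)"
    if \<tau>: "\<tau> \<in> T" and \<tau>': "\<tau>' \<in> T" for \<tau> \<tau>'
  proof -
    let ?G = "\<lambda>r X. of_bool (or_match X (col \<tau> r)) * of_bool (or_match X (col \<tau>' r)) :: real"
    have "?E (\<lambda>X. M \<tau> X * M \<tau>' X) = ?E (\<lambda>X. \<Prod>r\<in>R. ?G r X)"
      by (simp only: M_def prod.distrib)
    also have "\<dots> = (\<Prod>r\<in>R. ?E (?G r))"
    proof (rule expectation_prod_depends_on[OF I R])
      show "?D \<tau> r \<union> ?D \<tau>' r \<subseteq> I" if "r \<in> R" for r
        using DI[OF \<tau> that] DI[OF \<tau>' that] by auto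
      show "disjoint_family_on (\<lambda>r. ?D \<tau> r \<union> ?D \<tau>' r) R"
        using T[OF \<tau>] T[OF \<tau>'] \<sigma>_eq by (auto simp: disjoint_family_on_def col_def)
      show "depends_on (?G r) (?D \<tau> r \<union> ?D \<tau>' r)" for r
        by (rule depends_on_mult[OF dep dep])
    qed
    also have "\<dots> \<le> (\<Prod>r\<in>R. q\<^sup>2 * (\<Prod>i<4. w \<tau> \<tau>' i))"
    proof (rule prod_mono, rule conjI)
      fix r assume r: "r \<in> R"
      show "0 \<le> ?E (?G r)" by (intro integral_nonneg_AE) auto
      let ?e = "col \<tau> r" and ?f = "col \<tau>' r"
      \<comment> \<open>Distinct positions never share a coordinate, and a position is shared
        exactly when the two choices agree there. Hence each cardinality below is 4 minus the number
        of agreements in that half.\<close>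
      have eqs: "?e i = ?e j \<longleftrightarrow> i = j" "?f i = ?f j \<longleftrightarrow> i = j" "?e i = ?f j \<longleftrightarrow> i = j \<and> \<tau> i = \<tau>' i"
        "?f i = ?e j \<longleftrightarrow> i = j \<and> \<tau> i = \<tau>' i"
        if "i < 4" "j < 4" for i j
        using that \<sigma>_eq T[OF \<tau>] T[OF \<tau>'] r by (auto simp: col_def)
      have "?E (?G r) = match_form ((1 - p)\<^sup>2) ((1 - p) ^ card {?e 0, ?e 1, ?f 0, ?f 1})
          ((1 - p) ^ card {?e 2, ?e 3, ?f 2, ?f 3})"
        using DI[OF \<tau> r] DI[OF \<tau>' r]
        by (intro expectation_or_match_pair[OF I p']) (auto simp: eqs)
      also have "card {?e 0, ?e 1, ?f 0, ?f 1} = 4 - (of_bool (\<tau> 0 = \<tau>' 0) + of_bool (\<tau> 1 = \<tau>' 1))"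
        by (auto simp: eqs card_insert_if)
      also have "card {?e 2, ?e 3, ?f 2, ?f 3} = 4 - (of_bool (\<tau> 2 = \<tau>' 2) + of_bool (\<tau> 3 = \<tau>' 3))"
        by (auto simp: eqs card_insert_if)
      also have "match_form ((1 - p)\<^sup>2) ((1 - p) ^ (4 - (of_bool (\<tau> 0 = \<tau>' 0) + of_bool (\<tau> 1 = \<tau>' 1))))
          ((1 - p) ^ (4 - (of_bool (\<tau> 2 = \<tau>' 2) + of_bool (\<tau> 3 = \<tau>' 3)))) \<le>
        q\<^sup>2 * \<theta> ^ ((of_bool (\<tau> 0 = \<tau>' 0) + of_bool (\<tau> 1 = \<tau>' 1)) + (of_bool (\<tau> 2 = \<tau>' 2) + of_bool (\<tau> 3 = \<tau>' 3)))"
        by (rule match_form_le[OF _ _ q \<theta>]) (use p in auto)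
      also have "\<dots> = q\<^sup>2 * (\<Prod>i<4. w \<tau> \<tau>' i)"
        by (auto simp: w_def eval_nat_numeral lessThan_Suc)
      finally show "?E (?G r) \<le> q\<^sup>2 * (\<Prod>i<4. w \<tau> \<tau>' i)" .
    qed
    also have "\<dots> = q ^ (2 * k) * (\<Prod>i<4. w \<tau> \<tau>' i ^ k)"
      by (simp add: k_def power_mult_distrib power_mult prod_power_distrib)
    finally show ?thesis .
  qed
  \<comment> \<open>The sum over the second choice factorises over the four positions. In each, the
    one agreeing value contributes \<open>\<theta> ^ k\<close> and the rest at most
    \<open>b\<close>; the hypothesis \<open>\<theta> ^ card R \<le> real b\<close> bounds the total
    by \<open>2 * b\<close>.\<close>
  have row: "(\<Sum>\<tau>'\<in>T. \<Prod>i<4. w \<tau> \<tau>' i ^ k) \<le> (2 * real b) ^ 4" if \<tau>: "\<tau> \<in> T" for \<tau>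
  proof -
    have "(\<Sum>\<tau>'\<in>T. \<Prod>i<4. w \<tau> \<tau>' i ^ k) = (\<Sum>\<tau>'\<in>T. \<Prod>i<4. (if \<tau> i = \<tau>' i then \<theta> ^ k else 1))"
      unfolding w_def by (intro sum.cong prod.cong) auto
    also have "\<dots> = (\<Prod>i<4. \<Sum>a<b. if \<tau> i = a then \<theta> ^ k else 1)"
      unfolding T_def by (subst prod_sum_PiE) auto
    also have "\<dots> \<le> (\<Prod>i<4::nat. 2 * real b)"
    proof (rule prod_mono, rule conjI)
      fix i :: nat assume "i \<in> {..<4}"
      have "(\<Sum>a<b. if \<tau> i = a then \<theta> ^ k else 1) \<le> (\<Sum>a<b. (if \<tau> i = a then \<theta> ^ k else 0) + 1)"
        using \<theta> by (intro sum_mono) auto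
      also have "\<dots> = \<theta> ^ k + b"
        using T[OF \<tau>, of i] \<open>i \<in> _\<close> by (simp add: sum.distrib)
      also have "\<dots> \<le> 2 * real b" using b by (simp add: k_def)
      finally show "(\<Sum>a<b. if \<tau> i = a then \<theta> ^ k else 1) \<le> 2 * real b" .
    qed (use \<theta> in \<open>auto intro!: sum_nonneg\<close>)
    finally show ?thesis by simp
  qed
  have M0: "0 \<le> M \<tau> X" for \<tau> X unfolding M_def by (intro prod_nonneg) auto
  have EZZ: "?E (\<lambda>X. (Z X)\<^sup>2) \<le> 16 * real b ^ 8 * q ^ (2 * k)"
  proof -
    \<comment> \<open>The edge indicators are bounded by 1 here but kept in the mean; this
      discrepancy is the factor \<open>p ^ 4\<close> in the final bound.\<close>
    have "?E (\<lambda>X. (Z X)\<^sup>2) \<le> ?E (\<lambda>X. \<Sum>\<tau>\<in>T. \<Sum>\<tau>'\<in>T. M \<tau> X * M \<tau>' X)"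
    proof (rule integral_mono)
      fix X
      have "Z X \<le> (\<Sum>\<tau>\<in>T. M \<tau> X)"
        unfolding Z_def by (intro sum_mono) (auto simp: M0)
      moreover have "0 \<le> Z X"
        unfolding Z_def by (intro sum_nonneg) (auto simp: M0)
      ultimately have "(Z X)\<^sup>2 \<le> (\<Sum>\<tau>\<in>T. M \<tau> X)\<^sup>2" by (rule power_mono)
      then show "(Z X)\<^sup>2 \<le> (\<Sum>\<tau>\<in>T. \<Sum>\<tau>'\<in>T. M \<tau> X * M \<tau>' X)"
        by (simp add: power2_eq_square sum_product)
    qed (simp_all add: I)
    also have "\<dots> = (\<Sum>\<tau>\<in>T. \<Sum>\<tau>'\<in>T. ?E (\<lambda>X. M \<tau> X * M \<tau>' X))"
      by (simp add: Bochner_Integration.integral_sum I)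
    also have "\<dots> \<le> (\<Sum>\<tau>\<in>T. \<Sum>\<tau>'\<in>T. q ^ (2 * k) * (\<Prod>i<4. w \<tau> \<tau>' i ^ k))"
      by (intro sum_mono EMM)
    also have "\<dots> \<le> (\<Sum>\<tau>\<in>T. q ^ (2 * k) * (2 * real b) ^ 4)"
      unfolding sum_distrib_left[symmetric] using q0 by (intro mult_left_mono sum_mono row) auto
    also have "\<dots> = 16 * real b ^ 8 * q ^ (2 * k)"
      by (simp add: cardT power_mult_distrib flip: power_add)
    finally show ?thesis .
  qed
  have "(real b ^ 4 * (p\<^sup>2 * q ^ k))\<^sup>2 \<le> ?E (\<lambda>X. (Z X)\<^sup>2) * measure_pmf.prob ?P {X. Z X \<noteq> 0}"
    using prob_neq_0_ge_second_moment[OF I, of p Z] by (simp only: EZ)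
  also have "\<dots> \<le> (16 * real b ^ 8 * q ^ (2 * k)) * measure_pmf.prob ?P {X. Z X \<noteq> 0}"
    by (intro mult_right_mono EZZ) simp
  \<comment> \<open>The powers of \<open>b\<close> and \<open>q\<close> in the squared mean and in
    the second moment bound agree, so they cancel.\<close>
  also have "(real b ^ 4 * (p\<^sup>2 * q ^ k))\<^sup>2 = (16 * real b ^ 8 * q ^ (2 * k)) * (p ^ 4 / 16)"
    by (simp add: power_mult_distrib power_even_eq flip: power_mult)
  finally have main: "p ^ 4 / 16 \<le> measure_pmf.prob ?P {X. Z X \<noteq> 0}"
    by (rule mult_left_le_imp_le) (use b0 q0 in simp)
  let ?good = "\<lambda>X. \<exists>\<tau>\<in>T. X (\<eta> (\<tau> 0) (\<tau> 1)) \<and> X (\<eta>' (\<tau> 2) (\<tau> 3)) \<and> (\<forall>r\<in>R. or_match X (col \<tau> r))"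
  have "{X. Z X \<noteq> 0} \<subseteq> {X. ?good X}"
  proof safe
    fix X assume "Z X \<noteq> 0"
    then obtain \<tau> where "\<tau> \<in> T" and
      "of_bool (X (\<eta> (\<tau> 0) (\<tau> 1))) * (of_bool (X (\<eta>' (\<tau> 2) (\<tau> 3))) * M \<tau> X) \<noteq> 0"
      unfolding Z_def by (meson sum.neutral)
    then show "?good X"
      using R by (intro bexI[of _ \<tau>]) (auto simp: M_def)
  qed
  then have "measure_pmf.prob ?P {X. Z X \<noteq> 0} \<le> measure_pmf.prob ?P {X. ?good X}"
    by (intro measure_pmf.finite_measure_mono) auto
  moreover have "measure_pmf.prob ?P {X. \<not> ?good X} = 1 - measure_pmf.prob ?P {X. ?good X}"
    by (rule prob_Collect_not)
  ultimately show ?thesis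
    using main by (simp add: T_def col_def)
qed

subsection \<open>Edge distances in graphs with common neighbours\<close>

definition common_nbr :: "'a ugraph \<Rightarrow> bool" where
  "common_nbr G \<longleftrightarrow> (\<forall>x\<in>verts G. \<forall>y\<in>verts G. x \<noteq> y \<longrightarrow>
     (\<exists>w\<in>verts G - {x, y}. {x, w} \<in> edges G \<and> {w, y} \<in> edges G))"

text \<open>A common neighbour gives a path of length 2, and a path between distinct vertices with
  only one step is an edge.\<close>

lemma gdist_common_nbr:
  assumes c: "common_nbr G" and V: "x \<in> verts G" "r \<in> verts G" "x \<noteq> r"
  shows "gdist G x r = (if {x, r} \<in> edges G then 1 else 2)"
proof (rule antisym)
  obtain w where w: "w \<in> verts G - {x, r}" "{x, w} \<in> edges G" "{w, r} \<in> edges G"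
    using c V unfolding common_nbr_def by blast
  have "is_path G x r (if {x, r} \<in> edges G then [x, r] else [x, w, r])"
    using V w by (auto simp: is_path_def)
  then have "gdist G x r \<le> enat (length (if {x, r} \<in> edges G then [x, r] else [x, w, r]) - 1)"
    unfolding gdist_def by (intro INF_lower) simp
  also have "\<dots> = (if {x, r} \<in> edges G then 1 else 2)"
    by (simp add: one_enat_def numeral_eq_enat[of "num.Bit0 num.One"])
  finally show "gdist G x r \<le> (if {x, r} \<in> edges G then 1 else 2)" .
next
  show "(if {x, r} \<in> edges G then 1 else 2) \<le> gdist G x r"
    unfolding gdist_def
  proof (rule INF_greatest)
    fix xs assume "xs \<in> {xs. is_path G x r xs}"
    then have xs: "xs \<noteq> []" "hd xs = x" "last xs = r" "successively (\<lambda>x y. {x, y} \<in> edges G) xs"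
      by (auto simp: is_path_def)
    then obtain y ys where "xs = x # y # ys"
      using V(3) by (cases xs; cases "tl xs") auto
    with xs show "(if {x, r} \<in> edges G then 1 else 2) \<le> enat (length xs - 1)"
      by (cases ys) (auto simp: one_enat_def numeral_eq_enat[of "num.Bit0 num.One"])
  qed
qed

lemma edge_dist_common_nbr:
  assumes c: "common_nbr G" and V: "x \<in> verts G" "y \<in> verts G" "r \<in> verts G" "r \<notin> {x, y}"
  shows "edge_dist G {x, y} r = (if {x, r} \<in> edges G \<or> {y, r} \<in> edges G then 1 else 2)"
proof -
  have le: "(1::enat) \<le> 2" "\<not> (2::enat) \<le> 1"
    by (simp_all add: one_enat_def numeral_eq_enat[of "num.Bit0 num.One"])
  have "edge_dist G {x, y} r = min (gdist G x r) (gdist G y r)"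
    by (simp add: edge_dist_def)
  also have "gdist G x r = (if {x, r} \<in> edges G then 1 else 2)"
    using V by (intro gdist_common_nbr[OF c]) auto
  also have "gdist G y r = (if {y, r} \<in> edges G then 1 else 2)"
    using V by (intro gdist_common_nbr[OF c]) auto
  finally show ?thesis by (simp add: min_def le)
qed

text \<open>Since \<open>R\<close> avoids all four endpoints, no distance is 0, and each distance is
  1 or 2 according to adjacency alone. This turns the probabilistic test \<open>or_match\<close>
  into a failure of generation.\<close>

lemma collision_not_edge_generating:
  assumes c: "common_nbr G" and V: "{x, y, z, w} \<subseteq> verts G"
    and E: "{x, y} \<in> edges G" "{z, w} \<in> edges G" "{x, y} \<noteq> {z, w}" and R: "R \<inter> {x, y, z, w} = {}"
    and m: "\<And>r. r \<in> R \<Longrightarrow>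
      ({x, r} \<in> edges G \<or> {y, r} \<in> edges G) = ({z, r} \<in> edges G \<or> {w, r} \<in> edges G)"
  shows "\<not> edge_generating G R"
proof
  assume g: "edge_generating G R"
  then have RV: "R \<subseteq> verts G" by (simp add: edge_generating_def)
  have sep: "edge_dist_vec G R e \<noteq> edge_dist_vec G R e'"
    if "e \<in> edges G" "e' \<in> edges G" "e \<noteq> e'" for e e'
    using g that unfolding edge_generating_def by blast
  have "edge_dist_vec G R {x, y} = edge_dist_vec G R {z, w}"
    unfolding edge_dist_vec_def
  proof (rule restrict_ext)
    fix r assume r: "r \<in> R"
    have "edge_dist G {x, y} r = (if {x, r} \<in> edges G \<or> {y, r} \<in> edges G then 1 else 2)"
      by (rule edge_dist_common_nbr[OF c]) (use r V RV R in auto)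
    moreover have "edge_dist G {z, w} r = (if {z, r} \<in> edges G \<or> {w, r} \<in> edges G then 1 else 2)"
      by (rule edge_dist_common_nbr[OF c]) (use r V RV R in auto)
    ultimately show "edge_dist G {x, y} r = edge_dist G {z, w} r"
      by (simp only: m[OF r])
  qed
  with sep[OF E] show False by (rule notE)
qed

lemma edge_generating_superset:
  assumes g: "edge_generating G R" and R: "R \<subseteq> R'" "R' \<subseteq> verts G" "finite R'"
  shows "edge_generating G R'"
proof -
  have "edge_dist_vec G R e = edge_dist_vec G R e'" if "edge_dist_vec G R' e = edge_dist_vec G R' e'" for e e'
    unfolding edge_dist_vec_def
  proof (rule restrict_ext)
    fix r assume "r \<in> R"
    then have "r \<in> R'" using R(1) by blast
    then show "edge_dist G e r = edge_dist G e' r"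
      using fun_cong[OF that, of r] by (simp add: edge_dist_vec_def)
  qed
  then show ?thesis using g R unfolding edge_generating_def by blast
qed

text \<open>A minimum generating set can be padded with further vertices, since supersets still
  separate. The union bound then only has to run over sets of size exactly \<open>k\<close>.\<close>

lemma edge_generating_of_edim_le:
  assumes V: "finite (verts G)" "edges G \<subseteq> nsets (verts G) 2" and k: "edim G \<le> k" "k \<le> card (verts G)"
  obtains R where "R \<subseteq> verts G" "card R = k" "edge_generating G R"
proof -
  have "\<exists>R. edge_generating G R \<and> card R = edim G"
    unfolding edim_def by (rule LeastI_ex) (use edge_generating_verts[OF V] in blast)
  then obtain R where R: "edge_generating G R" "card R = edim G" by blast
  then have RV: "R \<subseteq> verts G" by (simp add: edge_generating_def)
  then obtain R' where R': "R \<subseteq> R'" "R' \<subseteq> verts G" "card R' = k"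
    using exists_subset_between[of R k "verts G"] R V k by auto
  then show thesis
    using that[of R'] edge_generating_superset[OF R(1)] V by (meson finite_subset)
qed

subsection \<open>Small edge generating sets are unlikely\<close>

definition field_graph :: "nat \<Rightarrow> (nat set \<Rightarrow> bool) \<Rightarrow> nat ugraph" where
  "field_graph n X = ({..<n}, {e \<in> nsets {..<n} 2. X e})"

lemma verts_field_graph [simp]: "verts (field_graph n X) = {..<n}"
  and edges_field_graph: "edges (field_graph n X) = {e \<in> nsets {..<n} 2. X e}"
  by (simp_all add: field_graph_def)

lemma doubleton_in_nsets_2 [simp]: "{x, y} \<in> nsets A 2 \<longleftrightarrow> x \<in> A \<and> y \<in> A \<and> x \<noteq> y"
  by (auto simp: nsets_def card_insert_if)

lemma finite_nsets_lessThan [simp]: "finite (nsets {..<n::nat} k)"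
  by (rule finite_imp_finite_nsets) simp

text \<open>There is room outside \<open>R\<close> for \<open>m\<close> disjoint blocks of four
  parts of size \<open>b\<close>. A collision in any block contradicts generation, so all
  \<open>m\<close> blocks must fail, and these failures are independent.\<close>

lemma prob_edge_generating_le:
  assumes p: "0 < p" "p < 1"
    and q: "q = 1 - 2 * (1 - p)\<^sup>2 + 2 * (1 - p) ^ 4" and \<theta>: "\<theta> > 0" "\<theta> ^ 4 * q = 1"
    and R: "R \<subseteq> {..<n}" and b: "\<theta> ^ card R \<le> real b" and n: "4 * m * b + card R \<le> n"
  shows "measure_pmf.prob (bernoulli_field (nsets {..<n} 2) p)
    {X. edge_generating (field_graph n X) R \<and> common_nbr (field_graph n X)} \<le> (1 - p ^ 4 / 16) ^ m"
proof -
  let ?I = "nsets {..<n} 2"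
  let ?P = "bernoulli_field ?I p"
  have finR: "finite R" using R finite_subset by blast
  let ?A = "{..<m} \<times> {..<4::nat} \<times> {..<b}"
  have "card ?A \<le> card ({..<n} - R)"
    using n R finR by (simp add: card_cartesian_product card_Diff_subset)
  \<comment> \<open>The vertex with label \<open>(l, i, a)\<close> is number \<open>a\<close> in
    part \<open>i\<close> of block \<open>l\<close>.\<close>
  then obtain \<nu> where \<nu>: "\<nu> ` ?A \<subseteq> {..<n} - R" and inj: "inj_on \<nu> ?A"
    using card_le_inj[of ?A "{..<n} - R"] by auto
  have \<nu>n: "\<nu> (l, i, a) < n" and \<nu>R: "\<nu> (l, i, a) \<notin> R" if "l < m" "i < 4" "a < b" for l i a
    using \<nu> that by (auto simp: image_subset_iff)
  have \<nu>_eq: "\<nu> (l, i, a) = \<nu> (l', i', a') \<longleftrightarrow> l = l' \<and> i = i' \<and> a = a'"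
    if "l < m" "i < 4" "a < b" "l' < m" "i' < 4" "a' < b" for l i a l' i' a'
    using inj_onD[OF inj, of "(l, i, a)" "(l', i', a')"] that by auto
  have Rn: "r < n" if "r \<in> R" for r using R that by auto
  define fail where "fail l X \<longleftrightarrow> \<not> (\<exists>\<tau>\<in>{..<4} \<rightarrow>\<^sub>E {..<b}. X {\<nu> (l, 0, \<tau> 0), \<nu> (l, 1, \<tau> 1)} \<and>
      X {\<nu> (l, 2, \<tau> 2), \<nu> (l, 3, \<tau> 3)} \<and> (\<forall>r\<in>R. or_match X (\<lambda>i. {\<nu> (l, i, \<tau> i), r})))" for l X
  have "{X. edge_generating (field_graph n X) R \<and> common_nbr (field_graph n X)} \<subseteq> {X. \<forall>l\<in>{..<m}. fail l X}"
  proof safe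
    fix X l assume g: "edge_generating (field_graph n X) R" and c: "common_nbr (field_graph n X)" and l: "l < m"
    show "fail l X"
    proof (rule ccontr)
      assume "\<not> fail l X"
      then obtain \<tau> where \<tau>: "\<tau> \<in> {..<4} \<rightarrow>\<^sub>E {..<b}" "X {\<nu> (l, 0, \<tau> 0), \<nu> (l, 1, \<tau> 1)}"
        "X {\<nu> (l, 2, \<tau> 2), \<nu> (l, 3, \<tau> 3)}" "\<forall>r\<in>R. or_match X (\<lambda>i. {\<nu> (l, i, \<tau> i), r})"
        unfolding fail_def by blast
      have T: "\<tau> i < b" if "i < 4" for i using \<tau>(1) that by (auto simp: PiE_def Pi_def)
      note T4 = T[of 0, simplified] T[of 1, simplified] T[of 2, simplified] T[of 3, simplified]
      have "\<not> edge_generating (field_graph n X) R"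
        by (rule collision_not_edge_generating[OF c, of "\<nu> (l, 0, \<tau> 0)" "\<nu> (l, 1, \<tau> 1)" "\<nu> (l, 2, \<tau> 2)" "\<nu> (l, 3, \<tau> 3)"])
           (use \<tau> T4 l in \<open>auto simp: edges_field_graph \<nu>n \<nu>R \<nu>_eq or_match_def doubleton_eq_iff Rn\<close>)
      then show False using g by simp
    qed
  qed
  then have "measure_pmf.prob ?P {X. edge_generating (field_graph n X) R \<and> common_nbr (field_graph n X)}
      \<le> measure_pmf.prob ?P {X. \<forall>l\<in>{..<m}. fail l X}"
    by (intro measure_pmf.finite_measure_mono) auto
  also have "\<dots> = measure_pmf.expectation ?P (\<lambda>X. \<Prod>l<m. of_bool (fail l X))"
    by (simp only: expectation_of_bool[symmetric] of_bool_Ball[OF finite_lessThan])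
  also have "\<dots> = (\<Prod>l<m. measure_pmf.expectation ?P (\<lambda>X. of_bool (fail l X)))"
  proof (rule expectation_prod_depends_on)
    let ?B = "\<lambda>l. (\<lambda>(i, a). \<nu> (l, i, a)) ` ({..<4} \<times> {..<b})"
    \<comment> \<open>The pairs that block \<open>l\<close> inspects: within the block, or from the
      block to \<open>R\<close>. Each meets its block, and no block meets another one or
      \<open>R\<close>, so these sets are disjoint for different \<open>l\<close>.\<close>
    let ?D = "\<lambda>l. {e \<in> ?I. e \<inter> ?B l \<noteq> {} \<and> e \<subseteq> ?B l \<union> R}"
    show "?D l \<subseteq> ?I" for l by auto
    show "disjoint_family_on ?D {..<m}"
      unfolding disjoint_family_on_def
    proof (intro ballI impI)
      fix l l' assume l: "l \<in> {..<m}" "l' \<in> {..<m}" "l \<noteq> l'"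
      have "?B l \<inter> (?B l' \<union> R) = {}" using l by (auto simp: \<nu>R \<nu>_eq)
      then show "?D l \<inter> ?D l' = {}" by blast
    qed
    show "depends_on (\<lambda>X. of_bool (fail l X) :: real) (?D l)" if "l \<in> {..<m}" for l
    proof (rule depends_onI)
      fix X Y :: "nat set \<Rightarrow> bool" assume eq: "\<And>e. e \<in> ?D l \<Longrightarrow> X e = Y e"
      have l: "l < m" using that by simp
      have B: "\<nu> (l, i, a) \<in> ?B l" if "i < 4" "a < b" for i a
        using that by (force intro: image_eqI[where x = "(i, a)"])
      have 1: "X {\<nu> (l, i, a), \<nu> (l, j, c)} = Y {\<nu> (l, i, a), \<nu> (l, j, c)}"
        if "i < 4" "a < b" "j < 4" "c < b" "i \<noteq> j" for i a j c
        by (rule eq) (use that l B in \<open>auto simp: \<nu>n \<nu>_eq\<close>)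
      have 2: "X {\<nu> (l, i, a), r} = Y {\<nu> (l, i, a), r}"
        if "i < 4" "a < b" "r \<in> R" for i a r
        by (rule eq) (use that l B \<nu>R[of l i a] in \<open>auto simp: \<nu>n Rn\<close>)
      have "fail l X \<longleftrightarrow> fail l Y"
        unfolding fail_def or_match_def
        by (intro arg_cong[where f = Not] bex_cong conj_cong ball_cong refl) (auto simp: 1 2 PiE_def Pi_def)
      then show "(of_bool (fail l X) :: real) = of_bool (fail l Y)" by simp
    qed
  qed auto
  also have "\<dots> \<le> (\<Prod>l<m. 1 - p ^ 4 / 16)"
  proof (rule prod_mono, rule conjI)
    fix l assume "l \<in> {..<m}"
    then have l: "l < m" by simp
    show "0 \<le> measure_pmf.expectation ?P (\<lambda>X. of_bool (fail l X) :: real)"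
      by (intro integral_nonneg_AE) auto
    have "measure_pmf.prob ?P {X. fail l X} \<le> 1 - p ^ 4 / 16"
      unfolding fail_def
    \<comment> \<open>Here \<open>\<sigma> i a r\<close> is the pair from vertex \<open>a\<close> of
      part \<open>i\<close> to \<open>r\<close>, while \<open>\<eta>\<close> and
      \<open>\<eta>'\<close> are the pairs between parts 0 and 1 and between parts 2 and 3.\<close>
    proof (rule block_failure_prob[OF _ finR p q \<theta> b])
      fix i a r j c t
      assume "i < (4::nat)" "a < b" "r \<in> R" "j < (4::nat)" "c < b" "t \<in> R"
      then show "{\<nu> (l, i, a), r} = {\<nu> (l, j, c), t} \<longleftrightarrow> i = j \<and> a = c \<and> r = t"
        using \<nu>R[OF l, of i a] \<nu>R[OF l, of j c] by (auto simp: doubleton_eq_iff \<nu>_eq l)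
    qed (use l in \<open>auto simp: \<nu>n \<nu>R \<nu>_eq Rn doubleton_eq_iff\<close>)
    then show "measure_pmf.expectation ?P (\<lambda>X. of_bool (fail l X)) \<le> 1 - p ^ 4 / 16"
      by (simp only: expectation_of_bool)
  qed
  finally show ?thesis by simp
qed

text \<open>For fixed \<open>x\<close> and \<open>y\<close>, the \<open>n - 2\<close> candidates
  \<open>w\<close> use disjoint pairs of coordinates, and each fails with probability
  \<open>1 - p\<^sup>2\<close>. A union bound over at most \<open>n ^ 2\<close> ordered pairs
  finishes.\<close>

lemma prob_not_common_nbr_le:
  assumes p: "0 \<le> p" "p \<le> 1"
  shows "measure_pmf.prob (bernoulli_field (nsets {..<n} 2) p) {X. \<not> common_nbr (field_graph n X)}
    \<le> real n ^ 2 * (1 - p\<^sup>2) ^ (n - 2)"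
proof -
  let ?I = "nsets {..<n} 2"
  let ?P = "bernoulli_field ?I p"
  let ?S = "{(x, y). x < n \<and> y < n \<and> x \<noteq> y}"
  have S: "?S \<subseteq> {..<n} \<times> {..<n}" by auto
  have finS: "finite ?S" by (rule finite_subset[OF S]) auto
  define bad where "bad x y X \<longleftrightarrow> (\<forall>w\<in>{..<n} - {x, y}. \<not> (X {x, w} \<and> X {w, y}))" for x y :: nat and X
  have bad: "measure_pmf.prob ?P {X. bad x y X} = (1 - p\<^sup>2) ^ (n - 2)" if xy: "x < n" "y < n" "x \<noteq> y" for x y
  proof -
    let ?W = "{..<n} - {x, y}"
    have "measure_pmf.prob ?P {X. bad x y X} =
        measure_pmf.expectation ?P (\<lambda>X. \<Prod>w\<in>?W. of_bool (\<not> (X {x, w} \<and> X {w, y})))"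
      unfolding bad_def by (subst of_bool_Ball[symmetric]) (auto simp only: expectation_of_bool finite_Diff finite_lessThan)
    also have "\<dots> = (\<Prod>w\<in>?W. measure_pmf.expectation ?P (\<lambda>X. of_bool (\<not> (X {x, w} \<and> X {w, y}))))"
      by (rule expectation_prod_depends_on[where D = "\<lambda>w. {{x, w}, {w, y}}"])
         (use xy in \<open>auto simp: disjoint_family_on_def depends_on_def doubleton_eq_iff\<close>)
    also have "\<dots> = (\<Prod>w\<in>?W. 1 - p\<^sup>2)"
    proof (rule prod.cong[OF refl])
      fix w assume w: "w \<in> ?W"
      have "measure_pmf.expectation ?P (\<lambda>X. of_bool (\<not> (X {x, w} \<and> X {w, y})) :: real) =
         measure_pmf.expectation ?P (\<lambda>X. 1 - of_bool (X {x, w}) * of_bool (X {w, y}))"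
        by (intro Bochner_Integration.integral_cong) auto
      also have "\<dots> = 1 - measure_pmf.expectation ?P (\<lambda>X. of_bool (X {x, w}) * of_bool (X {w, y}))"
        by (subst Bochner_Integration.integral_diff) simp_all
      also have "measure_pmf.expectation ?P (\<lambda>X. of_bool (X {x, w}) * of_bool (X {w, y}) :: real) =
          measure_pmf.expectation ?P (\<lambda>X. of_bool (X {x, w})) * measure_pmf.expectation ?P (\<lambda>X. of_bool (X {w, y}))"
        by (rule expectation_mult_depends_on[where A = "{{x, w}}" and B = "{{w, y}}"])
           (use w xy in \<open>auto simp: depends_on_def doubleton_eq_iff\<close>)
      also have "\<dots> = p\<^sup>2"
        using w xy p by (simp add: expectation_bernoulli_field_component power2_eq_square del: of_bool_eq)
      finally show "measure_pmf.expectation ?P (\<lambda>X. of_bool (\<not> (X {x, w} \<and> X {w, y}))) = 1 - p\<^sup>2" .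
    qed
    also have "\<dots> = (1 - p\<^sup>2) ^ (n - 2)"
      using xy by (simp add: card_Diff_subset numeral_2_eq_2)
    finally show ?thesis .
  qed
  have "{X. \<not> common_nbr (field_graph n X)} \<subseteq> (\<Union>(x, y)\<in>?S. {X. bad x y X})"
    by (auto simp: common_nbr_def bad_def edges_field_graph)
  then have "measure_pmf.prob ?P {X. \<not> common_nbr (field_graph n X)} \<le>
      measure_pmf.prob ?P (\<Union>(x, y)\<in>?S. {X. bad x y X})"
    by (intro measure_pmf.finite_measure_mono) auto
  also have "\<dots> \<le> (\<Sum>(x, y)\<in>?S. measure_pmf.prob ?P {X. bad x y X})"
    using measure_pmf.finite_measure_subadditive_finite[OF finS, of "\<lambda>(x, y). {X. bad x y X}" ?P]
    by (simp add: case_prod_unfold)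
  also have "\<dots> = (\<Sum>(x, y)\<in>?S. (1 - p\<^sup>2) ^ (n - 2))"
    by (intro sum.cong) (auto simp: bad)
  also have "\<dots> = real (card ?S) * (1 - p\<^sup>2) ^ (n - 2)" by (simp add: case_prod_unfold)
  also have "\<dots> \<le> real n ^ 2 * (1 - p\<^sup>2) ^ (n - 2)"
  proof (rule mult_right_mono)
    have "card ?S \<le> card ({..<n} \<times> {..<n})" by (rule card_mono) (use S in auto)
    also have "\<dots> = n ^ 2" by (simp add: power2_eq_square)
    finally have "real (card ?S) \<le> real (n ^ 2)" by (rule of_nat_mono)
    then show "real (card ?S) \<le> real n ^ 2" by (simp only: of_nat_power)
    show "0 \<le> (1 - p\<^sup>2) ^ (n - 2)" using p by (intro zero_le_power) (simp add: power_le_one)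
  qed
  finally show ?thesis .
qed

text \<open>Union bound over the sets of size \<open>k\<close>, with the graphs lacking some common
  neighbour split off as a separate error event.\<close>

lemma prob_edim_le:
  assumes p: "0 < p" "p < 1"
    and q: "q = 1 - 2 * (1 - p)\<^sup>2 + 2 * (1 - p) ^ 4" and \<theta>: "\<theta> > 0" "\<theta> ^ 4 * q = 1"
    and b: "\<theta> ^ k \<le> real b" and n: "4 * m * b + k \<le> n"
  shows "measure_pmf.prob (gnp n p) {G. edim G \<le> k}
    \<le> real n ^ k * (1 - p ^ 4 / 16) ^ m + real n ^ 2 * (1 - p\<^sup>2) ^ (n - 2)"
proof -
  let ?P = "bernoulli_field (nsets {..<n} 2) p"
  let ?K = "{R. R \<subseteq> {..<n} \<and> card R = k}"
  let ?B = "\<lambda>R. {X. edge_generating (field_graph n X) R \<and> common_nbr (field_graph n X)}"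
  let ?C = "{X. \<not> common_nbr (field_graph n X)}"
  have gnp: "gnp n p = map_pmf (field_graph n) ?P"
    by (simp add: gnp_def field_graph_def[abs_def])
  have finK: "finite ?K" by (rule finite_subset[of _ "Pow {..<n}"]) auto
  have "{X. edim (field_graph n X) \<le> k} \<subseteq> (\<Union>R\<in>?K. ?B R) \<union> ?C"
  proof
    fix X assume X: "X \<in> {X. edim (field_graph n X) \<le> k}"
    obtain R where "R \<subseteq> {..<n}" "card R = k" "edge_generating (field_graph n X) R"
      by (rule edge_generating_of_edim_le[of "field_graph n X" k])
         (use X n in \<open>auto simp: edges_field_graph\<close>)
    then show "X \<in> (\<Union>R\<in>?K. ?B R) \<union> ?C" by blast
  qed
  then have "measure_pmf.prob ?P {X. edim (field_graph n X) \<le> k} \<le> measure_pmf.prob ?P ((\<Union>R\<in>?K. ?B R) \<union> ?C)"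
    by (intro measure_pmf.finite_measure_mono) auto
  also have "\<dots> \<le> measure_pmf.prob ?P (\<Union>R\<in>?K. ?B R) + measure_pmf.prob ?P ?C"
    by (rule measure_Un_le) auto
  also have "measure_pmf.prob ?P (\<Union>R\<in>?K. ?B R) \<le> (\<Sum>R\<in>?K. measure_pmf.prob ?P (?B R))"
    by (rule measure_pmf.finite_measure_subadditive_finite[OF finK]) auto
  also have "\<dots> \<le> (\<Sum>R\<in>?K. (1 - p ^ 4 / 16) ^ m)"
    by (intro sum_mono prob_edge_generating_le[OF p q \<theta>]) (use b n in auto)
  also have "\<dots> = real (n choose k) * (1 - p ^ 4 / 16) ^ m"
    using n_subsets[of "{..<n}" k] by simp
  also have "\<dots> \<le> real n ^ k * (1 - p ^ 4 / 16) ^ m"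
  proof (rule mult_right_mono)
    have "n choose k \<le> n ^ k" using n by (intro binomial_le_pow) simp
    then show "real (n choose k) \<le> real n ^ k" by (metis of_nat_le_iff of_nat_power)
    have "p ^ 4 \<le> 1" using p by (intro power_le_one) auto
    then show "0 \<le> (1 - p ^ 4 / 16) ^ m" by simp
  qed
  also have "measure_pmf.prob ?P ?C \<le> real n ^ 2 * (1 - p\<^sup>2) ^ (n - 2)"
    using p by (intro prob_not_common_nbr_le) auto
  finally show ?thesis by (simp add: gnp vimage_def)
qed

section \<open>Choice of parameters and passage to the limit\<close>

lemma q_bounds:
  fixes p q :: real
  assumes p: "0 < p" "p < 1" and q: "q = 1 - 2 * p * (1 - p)\<^sup>2 * (2 - p)"
  shows "q = 1 - 2 * (1 - p)\<^sup>2 + 2 * (1 - p) ^ 4" "0 < q" "q < 1"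
proof -
  show *: "q = 1 - 2 * (1 - p)\<^sup>2 + 2 * (1 - p) ^ 4" unfolding q by algebra
  \<comment> \<open>With z the probability that neither of two pairs is an edge, \<open>q\<close> is
    z squared plus (1 - z) squared; completing the square shows that it is at least 1/2.\<close>
  have "2 * q = 1 + (1 - 2 * (1 - p)\<^sup>2)\<^sup>2" unfolding * by algebra
  then show "0 < q" using zero_le_power2[of "1 - 2 * (1 - p)\<^sup>2"] by linarith
  have "0 < 2 * p * (1 - p)\<^sup>2 * (2 - p)" using p by simp
  then show "q < 1" using q by simp
qed

theorem theorem4p1:
  fixes p q :: real
  assumes "0 < p" and "p < 1"
    and "q = 1 - 2 * p * (1 - p)\<^sup>2 * (2 - p)"
  shows "\<exists>\<epsilon> :: nat \<Rightarrow> real. \<epsilon> \<longlonglongrightarrow> 0 \<and>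
    (\<lambda>n. measure_pmf.prob (gnp n p)
           {G. real (edim G) \<ge> (1 + \<epsilon> n) * (4 * ln (real n) / ln (1 / q))}) \<longlonglongrightarrow> 1"
proof -
  note p = assms(1,2)
  note q = q_bounds[OF assms]
  define L where "L = ln (1 / q)"
  have L: "L > 0" using q by (simp add: L_def)
  define \<theta> where "\<theta> = exp (L / 4)"
  have \<theta>: "\<theta> > 0" "\<theta> ^ 4 * q = 1"
    using q(2) by (simp_all add: \<theta>_def L_def flip: exp_of_nat_mult)
  \<comment> \<open>The cube makes the failure exponent \<open>c * m n\<close> outgrow the exponent
    of order (ln n) squared in the number of sets of size \<open>k n\<close>.\<close>
  define m where "m n = nat \<lceil>ln (real n) ^ 3\<rceil>" for n :: nat
  \<comment> \<open>The blocks take \<open>4 * m n * b n\<close> vertices, at most half of all,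
    which leaves room for \<open>R\<close>.\<close>
  define b where "b n = n div (8 * m n)" for n
  \<comment> \<open>For \<open>b n \<ge> 1\<close>, the largest size with
    \<open>\<theta> ^ k n \<le> b n\<close>.\<close>
  define k where "k n = nat \<lfloor>4 * ln (real (b n)) / L\<rfloor>" for n
  \<comment> \<open>Solved from the requirement that the lower bound in the theorem be exactly
    \<open>k n\<close>.\<close>
  define \<epsilon> where "\<epsilon> n = real (k n) * L / (4 * ln (real n)) - 1" for n
  define c where "c = - ln (1 - p ^ 4 / 16)"
  define d where "d = - ln (1 - p\<^sup>2)"
  \<comment> \<open>The first term comes from the union bound over \<open>R\<close>, the second from
    missing common neighbours.\<close>
  define err where "err n = exp (4 * ln (real n) ^ 2 / L - c * ln (real n) ^ 3) + real n ^ 2 * exp (- d * (real n - 2))" for n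
  have p4: "0 < p ^ 4" "p ^ 4 < 1" "0 < p\<^sup>2" "p\<^sup>2 < 1"
    using p by (simp_all add: power_Suc_less_one power_less_one_iff)
  have c: "c > 0" and d: "d > 0"
    using p4 by (simp_all add: c_def d_def)

  have large: "eventually (\<lambda>n. n \<ge> 3) sequentially"
    by (rule eventually_ge_at_top)
  have b_large: "eventually (\<lambda>n. real n / (8 * (ln (real n) ^ 3 + 1)) - 1 \<ge> 1) sequentially"
    by real_asymp
  have k_small: "eventually (\<lambda>n. 4 * ln (real n) / L \<le> real n / 2) sequentially"
    using L by real_asymp

  \<comment> \<open>All rounding is absorbed here: \<open>k n\<close> is enclosed between explicit
    functions of ln n and the probability is bounded by \<open>err\<close>, so the limits below are
    elementary.\<close>
  have main: "eventually (\<lambda>n. 4 * ln (real n / (8 * (ln (real n) ^ 3 + 1)) - 1) / L - 1 \<le> real (k n) \<and>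
      real (k n) \<le> 4 * ln (real n) / L \<and> measure_pmf.prob (gnp n p) {G. edim G \<le> k n} \<le> err n) sequentially"
    using large b_large k_small
  proof eventually_elim
    case (elim n)
    have ln1: "ln (real n) > 0" using elim by simp
    have m: "ln (real n) ^ 3 \<le> real (m n)" "real (m n) \<le> ln (real n) ^ 3 + 1"
      using ln1 by (simp_all add: m_def)
    have m0: "real (m n) > 0" using m ln1 by (meson less_le_trans zero_less_power)
    have b_eq: "real n / (8 * real (m n)) - 1 \<le> real (b n)"
      using real_of_int_floor_ge_diff_one[of "real n / real (8 * m n)"]
      unfolding b_def floor_divide_of_nat_eq by simp
    have "real n / (8 * (ln (real n) ^ 3 + 1)) \<le> real n / (8 * real (m n))"
      using m m0 by (intro divide_left_mono) auto
    then have b: "real n / (8 * (ln (real n) ^ 3 + 1)) - 1 \<le> real (b n)"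
      using b_eq by linarith
    have b1: "real (b n) \<ge> 1" using b elim by linarith
    have bn: "8 * m n * b n \<le> n" unfolding b_def by (rule times_div_less_eq_dividend)
    have "b n \<le> n" unfolding b_def by (rule div_le_dividend)
    have lnb: "0 \<le> ln (real (b n))" "ln (real (b n)) \<le> ln (real n)"
      using b1 \<open>b n \<le> n\<close> by simp_all
    have k: "real (k n) \<le> 4 * ln (real (b n)) / L" "4 * ln (real (b n)) / L - 1 \<le> real (k n)"
      using lnb L by (simp_all add: k_def)
    have "ln (real n / (8 * (ln (real n) ^ 3 + 1)) - 1) \<le> ln (real (b n))"
      using b elim by (subst ln_le_cancel_iff) auto
    then have "4 * ln (real n / (8 * (ln (real n) ^ 3 + 1)) - 1) / L \<le> 4 * ln (real (b n)) / L"
      using L by (intro divide_right_mono) auto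
    then have k1: "4 * ln (real n / (8 * (ln (real n) ^ 3 + 1)) - 1) / L - 1 \<le> real (k n)"
      using k(2) by linarith
    have "4 * ln (real (b n)) / L \<le> 4 * ln (real n) / L"
      using L lnb by (intro divide_right_mono) auto
    then have k2: "real (k n) \<le> 4 * ln (real n) / L" using k(1) by linarith
    have "\<theta> ^ k n = exp (real (k n) * L / 4)"
      by (simp add: \<theta>_def flip: exp_of_nat_mult)
    also have "\<dots> \<le> exp (ln (real (b n)))"
      using k(1) L by (simp add: field_simps)
    finally have \<theta>b: "\<theta> ^ k n \<le> real (b n)" using b1 by simp
    have "real (k n) \<le> real n / 2" using k2 elim by linarith
    then have kn: "4 * m n * b n + k n \<le> n" using bn by linarith
    have "measure_pmf.prob (gnp n p) {G. edim G \<le> k n} \<le>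
        real n ^ k n * (1 - p ^ 4 / 16) ^ m n + real n ^ 2 * (1 - p\<^sup>2) ^ (n - 2)"
      by (rule prob_edim_le[OF p q(1) \<theta> \<theta>b kn])
    also have "real n ^ k n = exp (real (k n) * ln (real n))"
      using elim by (simp add: exp_of_nat_mult)
    also have "(1 - p ^ 4 / 16) ^ m n = exp (- c * real (m n))"
      using p4 by (simp add: c_def exp_of_nat2_mult)
    also have "(1 - p\<^sup>2) ^ (n - 2) = exp (- d * real (n - 2))"
      using p4 by (simp add: d_def exp_of_nat2_mult del: of_nat_diff)
    \<comment> \<open>Natural subtraction does not truncate because n is at least 3.\<close>
    also have "real (n - 2) = real n - 2" using elim by simp
    also have "exp (real (k n) * ln (real n)) * exp (- c * real (m n)) \<le>
        exp (4 * ln (real n) ^ 2 / L - c * ln (real n) ^ 3)"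
    proof -
      have "real (k n) * ln (real n) \<le> 4 * ln (real n) / L * ln (real n)"
        using k2 ln1 by (intro mult_right_mono) auto
      moreover have "c * ln (real n) ^ 3 \<le> c * real (m n)"
        using m c by (intro mult_left_mono) auto
      ultimately show ?thesis by (simp add: power2_eq_square flip: exp_add)
    qed
    finally show ?case using k1 k2 by (simp add: err_def)
  qed

  have "\<epsilon> \<longlonglongrightarrow> 0"
  proof (rule tendsto_sandwich)
    \<comment> \<open>Dividing n by a power of its logarithm does not change ln n to first order, so
      this lower bound tends to 0.\<close>
    show "eventually (\<lambda>n. (4 * ln (real n / (8 * (ln (real n) ^ 3 + 1)) - 1) / L - 1) * L / (4 * ln (real n)) - 1 \<le> \<epsilon> n) sequentially"
      using main large
    proof eventually_elim
      case (elim n)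
      then show ?case unfolding \<epsilon>_def using L
        by (intro diff_right_mono divide_right_mono mult_right_mono) auto
    qed
    show "eventually (\<lambda>n. \<epsilon> n \<le> 0) sequentially"
      using main large
    proof eventually_elim
      case (elim n)
      then show ?case unfolding \<epsilon>_def using L by (simp add: field_simps)
    qed
    show "(\<lambda>n. (4 * ln (real n / (8 * (ln (real n) ^ 3 + 1)) - 1) / L - 1) * L / (4 * ln (real n)) - 1) \<longlonglongrightarrow> 0"
      using L by real_asymp
  qed simp
  moreover have "(\<lambda>n. measure_pmf.prob (gnp n p) {G. real (edim G) \<ge> (1 + \<epsilon> n) * (4 * ln (real n) / L)}) \<longlonglongrightarrow> 1"
  proof (rule tendsto_sandwich[where h = "\<lambda>_. 1"])
    show "eventually (\<lambda>n. 1 - err n \<le>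
        measure_pmf.prob (gnp n p) {G. real (edim G) \<ge> (1 + \<epsilon> n) * (4 * ln (real n) / L)}) sequentially"
      using main large
    proof eventually_elim
      case (elim n)
      have "(1 + \<epsilon> n) * (4 * ln (real n) / L) = real (k n)"
        using L elim by (simp add: \<epsilon>_def)
      moreover have "1 - err n \<le> measure_pmf.prob (gnp n p) {G. \<not> edim G \<le> k n}"
        using elim by (simp only: prob_Collect_not) simp
      \<comment> \<open>Failure of \<open>edim G \<le> k n\<close> gives a strict inequality, of
        which only the weak form is kept.\<close>
      moreover have "\<dots> \<le> measure_pmf.prob (gnp n p) {G. real (edim G) \<ge> real (k n)}"
        by (intro measure_pmf.finite_measure_mono) auto
      ultimately show ?case by (simp only:)
    qed
    have "(\<lambda>n. exp (4 * ln (real n) ^ 2 / L - c * ln (real n) ^ 3)) \<longlonglongrightarrow> 0"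
      using L c by real_asymp
    moreover have "(\<lambda>n. real n ^ 2 * exp (- d * (real n - 2))) \<longlonglongrightarrow> 0"
      using d by real_asymp
    ultimately have "err \<longlonglongrightarrow> 0"
      unfolding err_def using tendsto_add by fastforce
    then show "(\<lambda>n. 1 - err n) \<longlonglongrightarrow> 1"
      using tendsto_diff[OF tendsto_const, of err 0 sequentially 1] by simp
  qed simp_all
  ultimately show ?thesis unfolding L_def by blast
qed

end
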